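(* Let $X$ be a $W$-hyperbolic space, $C\subseteq X$ a convex subset, and $(T_n:X\to X)_{n\in\mathbb{N}}$ a family of self-mappings of $X$ that have common fixed points, i.e. $F:=\bigcap_{n\in\mathbb{N}}\operatorname{Fix}(T_n)\neq\emptyset$. Let $\alpha_n=1-\frac{2}{n+2}$ and $\gamma_n=\frac{n+2}{n+1}$ for all $n\in\mathbb{N}$, and suppose that for all $y\in X$ and all $n,m\in\mathbb{N}$, $$d(T_ny,T_my)\le\frac{|\gamma_n-\gamma_m|}{\gamma_n}\,d(y,T_ny).$$ Let $x,u\in C$ and let $(x_n)$ be defined by $$x_0=x,\qquad x_{n+1}=(1-\alpha_n)u+\alpha_nT_nx_n\quad(n\in\mathbb{N}).$$ Let $p\in F$, let $M\in\mathbb{N}^*$ be such that $M\ge\max\{d(x,p),d(u,p)\}$, and define, for $k\in\mathbb{N}$, $$\Phi(k)=6M(k+1)-2,\qquad \Phi^*(k)=10M(k+1)-2,\qquad \tilde\Phi(k)=20M(k+1)-2.$$ Then $(x_n)$ is asymptotically regular with rate $\Phi$, $(T_n)$-asymptotically regular with rate $\Phi^*$, and, for all $m\in\mathbb{N}$, $T_m$-asymptotically regular with rate $\tilde\Phi$.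
   Context: $\mathbb{N}=\{0,1,2,\dots\}$ and $\mathbb{N}^*=\mathbb{N}\setminus\{0\}$. A $W$-hyperbolic space is a metric space $(X,d)$ together with a function $W:X\times X\times[0,1]\to X$, where one writes $(1-\lambda)x+\lambda y$ for $W(x,y,\lambda)$, such that for all $x,y,z,w\in X$ and $\lambda,\tilde\lambda\in[0,1]$: (W1) $d(z,W(x,y,\lambda))\le(1-\lambda)d(z,x)+\lambda d(z,y)$; (W2) $d(W(x,y,\lambda),W(x,y,\tilde\lambda))=|\lambda-\tilde\lambda|d(x,y)$; (W3) $W(x,y,\lambda)=W(y,x,1-\lambda)$; (W4) $d(W(x,z,\lambda),W(y,w,\lambda))\le(1-\lambda)d(x,y)+\lambda d(z,w)$. A nonempty subset $C\subseteq X$ is convex if $(1-\lambda)x+\lambda y\in C$ for all $x,y\in C$ and $\lambda\in[0,1]$. For a mapping $S:X\to X$, $\operatorname{Fix}(S)$ is its set of fixed points. For a sequence $(b_n)$ of nonnegative reals with limit $0$, a rate of convergence (towards $0$) is a function $\varphi:\mathbb{N}\to\mathbb{N}$ such that for all $k\in\mathbb{N}$ and all $n\ge\varphi(k)$, $b_n\le\frac{1}{k+1}$. A sequence $(x_n)$ is asymptotically regular with rate $\varphi$ if $d(x_n,x_{n+1})\to0$ with rate of convergence $\varphi$; it is $(T_n)$-asymptotically regular with rate $\varphi$ if $d(x_n,T_nx_n)\to0$ (as $n\to\infty$) with rate of convergence $\varphi$; for a fixed $m$, it is $T_m$-asymptotically regular with rate $\varphi$ if $d(x_n,T_mx_n)\to0$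 (as $n\to\infty$) with rate of convergence $\varphi$.
   Formalization: Each T_n is additionally assumed nonexpansive; without this the claim fails, e.g. for X=C=ℝ, T_n y=2y, x=u=1, p=0, M=1, where d(x_n,x_{n+1}) tends to infinity. *)

theory Defs
  imports "HOL-Analysis.Analysis"
begin

text \<open>
  The carrier of a W-hyperbolic space is a type of class \<^class>\<open>metric_space\<close>. The point
  \<open>(1 - l) x + l y\<close> is \<open>W x y l\<close>, so the parameter is the weight of the second argument.
  Only the values of \<open>W\<close> at parameters in \<open>[0, 1]\<close> matter.
\<close>

locale W_hyperbolic =
  fixes W :: "'a::metric_space \<Rightarrow> 'a \<Rightarrow> real \<Rightarrow> 'a"
  assumes W1: "\<And>x y z l. l \<in> {0..1} \<Longrightarrow>
      dist z (W x y l) \<le> (1 - l) * dist z x + l * dist z y"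
    and W2: "\<And>x y l l'. l \<in> {0..1} \<Longrightarrow> l' \<in> {0..1} \<Longrightarrow>
      dist (W x y l) (W x y l') = \<bar>l - l'\<bar> * dist x y"
    and W3: "\<And>x y l. l \<in> {0..1} \<Longrightarrow> W x y l = W y x (1 - l)"
    and W4: "\<And>x y z w l. l \<in> {0..1} \<Longrightarrow>
      dist (W x z l) (W y w l) \<le> (1 - l) * dist x y + l * dist z w"

definition W_convex :: "('a \<Rightarrow> 'a \<Rightarrow> real \<Rightarrow> 'a) \<Rightarrow> 'a set \<Rightarrow> bool" where
  "W_convex W C \<longleftrightarrow> C \<noteq> {} \<and> (\<forall>x\<in>C. \<forall>y\<in>C. \<forall>l\<in>{0..1}. W x y l \<in> C)"

definition Fix :: "('a \<Rightarrow> 'a) \<Rightarrow> 'a set" where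
  "Fix S = {x. S x = x}"

definition nonexpansive :: "('a::metric_space \<Rightarrow> 'a) \<Rightarrow> bool" where
  "nonexpansive S \<longleftrightarrow> (\<forall>x y. dist (S x) (S y) \<le> dist x y)"

definition tends_to_0_with_rate :: "(nat \<Rightarrow> real) \<Rightarrow> (nat \<Rightarrow> nat) \<Rightarrow> bool" where
  "tends_to_0_with_rate b \<phi> \<longleftrightarrow>
     b \<longlonglongrightarrow> 0 \<and> (\<forall>k. \<forall>n\<ge>\<phi> k. b n \<le> 1 / (real k + 1))"

definition asymptotically_regular ::
    "(nat \<Rightarrow> 'a::metric_space) \<Rightarrow> (nat \<Rightarrow> nat) \<Rightarrow> bool" where
  "asymptotically_regular x \<phi> \<longleftrightarrow> tends_to_0_with_rate (\<lambda>n. dist (x n) (x (Suc n))) \<phi>"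

definition family_asymptotically_regular ::
    "(nat \<Rightarrow> 'a \<Rightarrow> 'a) \<Rightarrow> (nat \<Rightarrow> 'a::metric_space) \<Rightarrow> (nat \<Rightarrow> nat) \<Rightarrow> bool" where
  "family_asymptotically_regular T x \<phi> \<longleftrightarrow> tends_to_0_with_rate (\<lambda>n. dist (x n) (T n (x n))) \<phi>"

definition map_asymptotically_regular ::
    "('a \<Rightarrow> 'a) \<Rightarrow> (nat \<Rightarrow> 'a::metric_space) \<Rightarrow> (nat \<Rightarrow> nat) \<Rightarrow> bool" where
  "map_asymptotically_regular S x \<phi> \<longleftrightarrow> tends_to_0_with_rate (\<lambda>n. dist (x n) (S (x n))) \<phi>"

end

theory Submission imports Defs "HOL-Real_Asymp.Real_Asymp" begin

text \<open>
  All orbit points and their images stay within \<open>M\<close> of \<open>p\<close>. Writing \<open>s\<^sub>n\<close> for the distance of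
  consecutive iterates, (W2), (W4) and the hypothesis on \<open>T\<^sub>n\<close> give
  \<open>s\<^sub>n\<^sub>+\<^sub>1 \<le> (n + 1) / (n + 3) (s\<^sub>n + 2M / (n + 2)\<^sup>2) + 4M / ((n + 2) (n + 3))\<close>,
  whose solutions satisfy \<open>s\<^sub>n \<le> 6M / (n + 2)\<close>. As \<open>x\<^sub>n\<^sub>+\<^sub>1\<close> is within \<open>4M / (n + 2)\<close> of
  \<open>T\<^sub>n x\<^sub>n\<close>, the second rate follows, and the third one costs a factor \<open>2\<close> because
  \<open>\<bar>\<gamma>\<^sub>n - \<gamma>\<^sub>m\<bar> \<le> \<gamma>\<^sub>n\<close>.
\<close>

text \<open>Pass through \<open>W u y l'\<close>: (W2) pays for the change of parameter, (W4) for
  the change of endpoint, where the shared \<open>u\<close> contributes nothing.\<close>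

lemma (in W_hyperbolic) W_left_dist_le:
  assumes "l \<in> {0..1}" "l' \<in> {0..1}"
  shows "dist (W u y l) (W u z l') \<le> l' * dist y z + \<bar>l - l'\<bar> * dist u y"
proof -
  have "dist (W u y l) (W u z l') \<le> dist (W u y l) (W u y l') + dist (W u y l') (W u z l')"
    by (rule dist_triangle)
  also have "\<dots> \<le> \<bar>l - l'\<bar> * dist u y + l' * dist y z"
    using W2[OF assms, of u y] W4[OF assms(2), of u y u z] by simp
  finally show ?thesis by simp
qed

lemma (in W_hyperbolic) dist_W_right_le:
  assumes "l \<in> {0..1}"
  shows "dist y (W u y l) \<le> (1 - l) * dist u y"
  using W1[OF assms, of y u y] by (simp add: dist_commute)

lemma (in W_hyperbolic) dist_W_le:
  assumes "l \<in> {0..1}" "dist u p \<le> r" "dist y p \<le> r"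
  shows "dist (W u y l) p \<le> r"
proof -
  have "dist (W u y l) p \<le> (1 - l) * dist u p + l * dist y p"
    using W1[OF assms(1), of p u y] by (simp add: dist_commute)
  also have "\<dots> \<le> r"
    using assms by (intro convex_bound_le) auto
  finally show ?thesis .
qed

text \<open>Reduces each of the three claims to a pointwise bound, with \<open>K\<close> equal to
  \<open>6 * M\<close>, \<open>10 * M\<close> and \<open>20 * M\<close>.\<close>

lemma tends_to_0_with_rate_inverse:
  fixes b :: "nat \<Rightarrow> real"
  assumes "\<And>n. 0 \<le> b n" "\<And>n. b n \<le> real K / (real n + 2)"
    and "\<And>k. \<phi> k = K * (k + 1) - 2"
  shows "tends_to_0_with_rate b \<phi>"
  unfolding tends_to_0_with_rate_def
proof (intro conjI allI impI)
  have *: "(\<lambda>n. real K / (real n + 2)) \<longlonglongrightarrow> 0"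
    by real_asymp
  show "b \<longlonglongrightarrow> 0"
    by (rule tendsto_sandwich[OF _ _ tendsto_const *]) (use assms in auto)
next
  fix k n assume "\<phi> k \<le> n"
  \<comment> \<open>This survives truncated subtraction: if \<open>\<phi> k\<close> is cut off at 0,
    then \<open>K * (k + 1)\<close> is at most 2.\<close>
  then have "K * (k + 1) \<le> n + 2"
    using assms(3)[of k] by linarith
  then have "real K * (real k + 1) \<le> real n + 2"
    by (metis of_nat_1 of_nat_add of_nat_le_iff of_nat_mult of_nat_numeral)
  then have "real K / (real n + 2) \<le> 1 / (real k + 1)"
    by (simp add: divide_simps)
  then show "b n \<le> 1 / (real k + 1)"
    using assms(2)[of n] by linarith
qed

text \<open>Inserting \<open>c * M / t\<close> with \<open>t = n + 2\<close> into the right-hand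
  side gives \<open>M * (c * t^2 + (6 - c) * t - 2) / (t^2 * (t + 1))\<close>. The choice
  \<open>c = 6\<close> cancels the linear term and is the least constant for which the induction
  step works for all \<open>t\<close>.\<close>

lemma recursion_bound:
  fixes s :: "nat \<Rightarrow> real"
  assumes "0 \<le> M" "s 0 \<le> 2 * M"
    and step: "\<And>n. s (Suc n) \<le> (real n + 1) / (real n + 3) * (s n + 2 * M / (real n + 2)^2)
      + 4 * M / ((real n + 2) * (real n + 3))"
  shows "s n \<le> 6 * M / (real n + 2)"
proof (induction n)
  case 0
  then show ?case using assms by simp
next
  case (Suc n)
  define t where "t = real n + 2"
  have t: "t \<ge> 2" by (simp add: t_def)
  have "s (Suc n) \<le> (t - 1) / (t + 1) * (s n + 2 * M / t^2) + 4 * M / (t * (t + 1))"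
    using step[of n] by (simp add: t_def algebra_simps)
  also have "\<dots> \<le> (t - 1) / (t + 1) * (6 * M / t + 2 * M / t^2) + 4 * M / (t * (t + 1))"
    using Suc.IH t by (intro add_mono mult_left_mono) (auto simp: t_def)
  also have "\<dots> = 6 * M / (t + 1) - 2 * M / (t^2 * (t + 1))"
    using t by (simp add: divide_simps) (simp add: algebra_simps power2_eq_square)
  also have "\<dots> \<le> 6 * M / (t + 1)"
    using t \<open>0 \<le> M\<close> by simp
  finally show ?case by (simp add: t_def add.commute)
qed

text \<open>All values of \<open>g\<close> lie in the interval (1, 2], so two of them differ by less
  than 1, hence by less than \<open>g n\<close>.\<close>

lemma gamma_diff_le:
  fixes n m :: nat
  defines "g \<equiv> \<lambda>n::nat. (real n + 2) / (real n + 1)"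
  shows "\<bar>g n - g m\<bar> / g n \<le> 1"
proof -
  have g: "1 < g k \<and> g k \<le> 2" for k
    by (simp add: g_def divide_simps)
  have "\<bar>g n - g m\<bar> \<le> g n"
    using g[of n] g[of m] by linarith
  then show ?thesis using g[of n] by (simp add: divide_le_eq)
qed

theorem proposition3p10:
  fixes W :: "'a::metric_space \<Rightarrow> 'a \<Rightarrow> real \<Rightarrow> 'a"
    and C :: "'a set"
    and T :: "nat \<Rightarrow> 'a \<Rightarrow> 'a"
    and \<alpha> \<gamma> :: "nat \<Rightarrow> real"
    and x u p :: 'a
    and xs :: "nat \<Rightarrow> 'a"
    and M :: nat
    and \<Phi> \<Phi>' \<Phi>'' :: "nat \<Rightarrow> nat"
  assumes "W_hyperbolic W"
    and "W_convex W C"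
    and "\<And>n. nonexpansive (T n)"
    and "(\<Inter>n. Fix (T n)) \<noteq> {}"
    and "\<And>n. \<alpha> n = 1 - 2 / (real n + 2)"
    and "\<And>n. \<gamma> n = (real n + 2) / (real n + 1)"
    and "\<And>y n m. dist (T n y) (T m y) \<le> \<bar>\<gamma> n - \<gamma> m\<bar> / \<gamma> n * dist y (T n y)"
    and "x \<in> C" and "u \<in> C"
    and "xs 0 = x"
    and "\<And>n. xs (Suc n) = W u (T n (xs n)) (\<alpha> n)"
    and "p \<in> (\<Inter>n. Fix (T n))"
    and "M \<noteq> 0"
    and "real M \<ge> max (dist x p) (dist u p)"
    and "\<And>k. \<Phi> k = 6 * M * (k + 1) - 2"
    and "\<And>k. \<Phi>' k = 10 * M * (k + 1) - 2"
    and "\<And>k. \<Phi>'' k = 20 * M * (k + 1) - 2"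
  shows "asymptotically_regular xs \<Phi>
    \<and> family_asymptotically_regular T xs \<Phi>'
    \<and> (\<forall>m. map_asymptotically_regular (T m) xs \<Phi>'')"
proof -
  interpret W_hyperbolic W by fact
  note xs_Suc = assms(11)
  have \<alpha>_mem: "\<alpha> n \<in> {0..1}" for n
    by (simp add: assms(5))
  have T_p: "dist (T m y) p \<le> dist y p" for m y
  proof -
    have "T m p = p" using assms(12) by (simp add: Fix_def)
    then show ?thesis using assms(3)[of m] unfolding nonexpansive_def by metis
  qed
  have M: "dist x p \<le> M" "dist u p \<le> M"
    using assms(14) by auto
  have xs_p: "dist (xs n) p \<le> M" for n
  proof (induction n)
    case 0
    then show ?case using M assms(10) by simp
  next
    case (Suc n)
    then show ?case
      unfolding xs_Suc using T_p[of n "xs n"] by (intro dist_W_le \<alpha>_mem M) linarith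
  qed
  have 2: "dist y z \<le> 2 * M" if "dist y p \<le> M" "dist z p \<le> M" for y z
    using dist_triangle2[of y z p] that by linarith
  have T_le: "dist (T m (xs n)) p \<le> M" for m n
    using T_p[of m "xs n"] xs_p[of n] by linarith

  define s where "s = (\<lambda>n. dist (xs n) (xs (Suc n)))"
  have s_0: "s 0 \<le> 2 * M"
    unfolding s_def by (intro 2 xs_p)
  have s_Suc: "s (Suc n) \<le> (real n + 1) / (real n + 3) * (s n + 2 * M / (real n + 2)^2)
      + 4 * M / ((real n + 2) * (real n + 3))" for n
  proof -
    let ?y = "T n (xs n)" and ?z = "T (Suc n) (xs (Suc n))"
    have "dist ?y (T (Suc n) (xs n)) \<le> \<bar>\<gamma> n - \<gamma> (Suc n)\<bar> / \<gamma> n * dist (xs n) ?y"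
      by (rule assms(7))
    \<comment> \<open>The difference is 1/((n+1)(n+2)); division by (n+2)/(n+1) cancels the factor
      n+1.\<close>
    also have "\<bar>\<gamma> n - \<gamma> (Suc n)\<bar> / \<gamma> n = 1 / (real n + 2)^2"
    proof -
      have "\<gamma> n - \<gamma> (Suc n) = 1 / ((real n + 1) * (real n + 2))"
        unfolding assms(6) by (simp add: divide_simps) (simp add: algebra_simps)
      then show ?thesis
        unfolding assms(6) by (simp add: power2_eq_square)
    qed
    also have "1 / (real n + 2)^2 * dist (xs n) ?y \<le> 1 / (real n + 2)^2 * (2 * M)"
      by (intro mult_left_mono 2 xs_p T_le) simp
    finally have "dist ?y (T (Suc n) (xs n)) \<le> 2 * M / (real n + 2)^2"
      by simp
    moreover have "dist (T (Suc n) (xs n)) ?z \<le> s n"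
      using assms(3)[of "Suc n"] unfolding nonexpansive_def s_def by blast
    \<comment> \<open>The intermediate point \<open>T (Suc n) (xs n)\<close> separates the change of
      map from the change of argument.\<close>
    ultimately have yz: "dist ?y ?z \<le> s n + 2 * M / (real n + 2)^2"
      using dist_triangle[of ?y ?z "T (Suc n) (xs n)"] by linarith
    have "s (Suc n) = dist (W u ?y (\<alpha> n)) (W u ?z (\<alpha> (Suc n)))"
      by (simp only: s_def xs_Suc)
    \<comment> \<open>The factor \<open>\<alpha> (Suc n) < 1\<close> in front of
      \<open>dist ?y ?z\<close> is what makes \<open>s\<close> decay.\<close>
    also have "\<dots> \<le> \<alpha> (Suc n) * dist ?y ?z + \<bar>\<alpha> n - \<alpha> (Suc n)\<bar> * dist u ?y"
      by (rule W_left_dist_le[OF \<alpha>_mem \<alpha>_mem])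
    also have "\<dots> \<le> \<alpha> (Suc n) * (s n + 2 * M / (real n + 2)^2)
        + \<bar>\<alpha> n - \<alpha> (Suc n)\<bar> * (2 * M)"
      using \<alpha>_mem[of "Suc n"] by (intro add_mono mult_left_mono yz 2 M T_le) auto
    also have "\<alpha> (Suc n) = (real n + 1) / (real n + 3)"
      unfolding assms(5) by (simp add: field_simps)
    also have "\<bar>\<alpha> n - (real n + 1) / (real n + 3)\<bar> = 2 / ((real n + 2) * (real n + 3))"
    proof -
      have "\<alpha> n - (real n + 1) / (real n + 3) = - (2 / ((real n + 2) * (real n + 3)))"
        unfolding assms(5) by (simp add: divide_simps) (simp add: algebra_simps)
      then show ?thesis by simp
    qed
    finally show ?thesis by simp
  qed
  have s_le: "s n \<le> 6 * M / (real n + 2)" for n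
    using recursion_bound[of "real M" s] s_0 s_Suc by simp

  have T_n_le: "dist (xs n) (T n (xs n)) \<le> 10 * M / (real n + 2)" for n
  proof -
    have "dist (T n (xs n)) (xs (Suc n)) \<le> (1 - \<alpha> n) * dist u (T n (xs n))"
      unfolding xs_Suc by (rule dist_W_right_le[OF \<alpha>_mem])
    also have "\<dots> \<le> (1 - \<alpha> n) * (2 * M)"
      using \<alpha>_mem[of n] by (intro mult_left_mono 2 M T_le) auto
    \<comment> \<open>The weight of \<open>u\<close> is \<open>1 - \<alpha> n\<close>, that is
      2/(n+2).\<close>
    also have "\<dots> = 4 * M / (real n + 2)"
      by (simp add: assms(5))
    finally have "dist (xs n) (T n (xs n)) \<le> s n + 4 * M / (real n + 2)"
      unfolding s_def using dist_triangle2[of "xs n" "T n (xs n)" "xs (Suc n)"] by linarith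
    also have "\<dots> \<le> 6 * M / (real n + 2) + 4 * M / (real n + 2)"
      using s_le[of n] by simp
    finally show ?thesis by (simp add: add_divide_distrib[symmetric])
  qed
  have T_m_le: "dist (xs n) (T m (xs n)) \<le> 20 * M / (real n + 2)" for n m
  proof -
    \<comment> \<open>With \<open>n\<close> as the first index, the right-hand side involves only
      the displacement under \<open>T n\<close>, which is already bounded; hence the estimate is
      uniform in \<open>m\<close>.\<close>
    have "dist (T n (xs n)) (T m (xs n)) \<le> \<bar>\<gamma> n - \<gamma> m\<bar> / \<gamma> n * dist (xs n) (T n (xs n))"
      by (rule assms(7))
    also have "\<dots> \<le> 1 * dist (xs n) (T n (xs n))"
      unfolding assms(6) by (intro mult_right_mono gamma_diff_le) simp
    finally show ?thesis
      using dist_triangle[of "xs n" "T m (xs n)" "T n (xs n)"] T_n_le[of n] by simp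
  qed

  show ?thesis
    unfolding asymptotically_regular_def family_asymptotically_regular_def
      map_asymptotically_regular_def
  proof (intro conjI allI)
    show "tends_to_0_with_rate (\<lambda>n. dist (xs n) (xs (Suc n))) \<Phi>"
      by (rule tends_to_0_with_rate_inverse[of _ "6 * M"]) (use s_le assms(15) in \<open>auto simp: s_def\<close>)
    show "tends_to_0_with_rate (\<lambda>n. dist (xs n) (T n (xs n))) \<Phi>'"
      by (rule tends_to_0_with_rate_inverse[of _ "10 * M"]) (use T_n_le assms(16) in auto)
    show "tends_to_0_with_rate (\<lambda>n. dist (xs n) (T m (xs n))) \<Phi>''" for m
      by (rule tends_to_0_with_rate_inverse[of _ "20 * M"]) (use T_m_le assms(17) in auto)
  qed
qed

end
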